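(* Let $q,\xi\in(0,1)$. Let $\{\pi_n\}_{n\ge0}$ and $\{\check\pi_n\}_{n\ge0}$ be the monic orthogonal polynomials on the unit circle with respect to the weights $$\mathbb{I}(z)=\prod_{k\ge0}\frac1{(1-\xi q^{k+\frac12}z)(1-\xi q^{k+\frac12}z^{-1})},\qquad \check{\mathbb{I}}(z)=\prod_{k\ge0}(1+\xi q^{k+\frac12}z)(1+\xi q^{k+\frac12}z^{-1}),$$ respectively. Set $\mathsf{x}_n=\xi^{\frac12}q^{\frac n2}\pi_n(0)$ and $\mathsf{y}_n=(-\xi)^{\frac12}q^{-\frac n2}\check\pi_n(0)$, where $(-\xi)^{\frac12}$ is a fixed square root of $-\xi$. Then for all $n\ge1$ $$(\mathsf{x}_n\mathsf{x}_{n+1}-1)(\mathsf{x}_{n-1}\mathsf{x}_n-1)=\frac{(\mathsf{x}_n^2-\xi)(\mathsf{x}_n^2-\xi^{-1})}{1-\xi^{-1}q^{-n}\mathsf{x}_n^2},$$ $$(\mathsf{y}_n\mathsf{y}_{n+1}-1)(\mathsf{y}_{n-1}\mathsf{y}_n-1)=\frac{(\mathsf{y}_n^2+\xi)(\mathsf{y}_n^2+\xi^{-1})}{1+\xi^{-1}q^{n}\mathsf{y}_n^2},$$ with $\mathsf{x}_0=\xi^{\frac12}$ and $\mathsf{y}_0=(-\xi)^{\frac12}$.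
   Context: For a weight $w$ that is continuous and positive on the unit circle $\mathbb{T}=\{|z|=1\}$ (as both weights above are), the inner product is $\langle f,g\rangle_w=\oint_{\mathbb{T}}f(z)\overline{g(z)}\,w(z)\frac{dz}{2\pi i z}$. The monic orthogonal polynomials with respect to $w$ are the unique monic polynomials of degree $n=0,1,2,\dots$ that are pairwise orthogonal for $\langle\cdot,\cdot\rangle_w$. *)

theory Defs
  imports "HOL-Complex_Analysis.Complex_Analysis" "HOL-Computational_Algebra.Polynomial"
begin

definition circle_inner ::
    "(complex \<Rightarrow> complex) \<Rightarrow> (complex \<Rightarrow> complex) \<Rightarrow> (complex \<Rightarrow> complex) \<Rightarrow> complex"
  where "circle_inner w f g =
    contour_integral (circlepath 0 1)
      (\<lambda>z. f z * cnj (g z) * w z / (2 * complex_of_real pi * \<i> * z))"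

(* Intended for weights that are continuous and positive on the unit circle. For these
   exactly one sequence P satisfies the predicate, so the predicate specifies
   "the" monic orthogonal polynomials. *)
definition monic_orthogonal_polys ::
    "(complex \<Rightarrow> complex) \<Rightarrow> (nat \<Rightarrow> complex poly) \<Rightarrow> bool"
  where "monic_orthogonal_polys w P \<longleftrightarrow>
    (\<forall>n. degree (P n) = n \<and> lead_coeff (P n) = 1) \<and>
    (\<forall>m n. m \<noteq> n \<longrightarrow> circle_inner w (poly (P m)) (poly (P n)) = 0)"

definition weight_I :: "real \<Rightarrow> real \<Rightarrow> complex \<Rightarrow> complex"
  where "weight_I q \<xi> z =
    (\<Prod>k. 1 / ((1 - complex_of_real (\<xi> * q powr (real k + 1/2)) * z) *
              (1 - complex_of_real (\<xi> * q powr (real k + 1/2)) * inverse z)))"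

definition weight_I_check :: "real \<Rightarrow> real \<Rightarrow> complex \<Rightarrow> complex"
  where "weight_I_check q \<xi> z =
    (\<Prod>k. (1 + complex_of_real (\<xi> * q powr (real k + 1/2)) * z) *
         (1 + complex_of_real (\<xi> * q powr (real k + 1/2)) * inverse z))"

end

(* Both weights satisfy a q-Pearson equation w(pz)(1 - b/(pz)) = w(z)(1 - bz), the first with p = q,
   b = xi q^(1/2), the second with p = 1/q, b = -xi q^(-1/2). Shifting the contour inside the annulus
   where w is holomorphic turns it into a recurrence for the moments, so one argument covers both cases.
   By that recurrence (1 - bz) pi_n(pz) is orthogonal to 1, ..., z^(n-2), hence a combination of
   pi_(n+1), pi_n, pi_(n-1); comparing coefficients gives a relation between alpha_k = pi_k(0)
   (k = n-1, n, n+1) and the subleading coefficient s_n of pi_n. By Szego's recursion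
   s_(n+1) = s_n + alpha_n alpha_(n+1), and an induction yields the first integral
     b p^n (1 - alpha_n^2) alpha_(n-1) alpha_(n+1) = (p - 1) s_n + b (p^n alpha_n^2 - 1).
   Eliminating s_n leaves the stated equation. *)

theory Submission
  imports Defs
begin

section \<open>Orthogonality for a symmetric moment form\<close>

text \<open>For moments c k = <z^k, 1>, this is the pairing <f, z^k>. The index k is an integer
  because shifts and reversal lead to negative exponents.\<close>

definition moment_form :: "(int \<Rightarrow> 'a::comm_ring_1) \<Rightarrow> 'a poly \<Rightarrow> int \<Rightarrow> 'a" where
  "moment_form c f k = (\<Sum>i\<le>degree f. coeff f i * c (int i - k))"

section \<open>Linearity, shift and reversal of the moment form\<close>

lemma moment_form_eq:
  assumes "degree f \<le> N"
  shows "moment_form c f k = (\<Sum>i\<le>N. coeff f i * c (int i - k))"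
  unfolding moment_form_def
  by (rule sum.mono_neutral_left) (use assms in \<open>auto simp: coeff_eq_0 not_le\<close>)

lemma moment_form_add: "moment_form c (f + g) k = moment_form c f k + moment_form c g k"
proof -
  let ?N = "max (degree f) (degree g)"
  have "degree (f + g) \<le> ?N" by (rule degree_add_le_max)
  then show ?thesis
    by (simp add: moment_form_eq[of _ ?N] sum.distrib distrib_right)
qed

lemma moment_form_smult: "moment_form c (smult a f) k = a * moment_form c f k"
  unfolding moment_form_eq[OF degree_smult_le, of c a f]
  by (simp add: moment_form_def sum_distrib_left mult.assoc)

lemma moment_form_diff: "moment_form c (f - g) k = moment_form c f k - moment_form c g k"
  using moment_form_add[of c f "smult (-1) g" k] moment_form_smult[of c "-1" g k] by simp

lemma moment_form_pCons_0: "moment_form c (pCons 0 f) k = moment_form c f (k - 1)"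
proof -
  have "moment_form c (pCons 0 f) k =
      (\<Sum>i\<le>Suc (degree f). coeff (pCons 0 f) i * c (int i - k))"
    by (rule moment_form_eq) (simp add: degree_pCons_le)
  also have "\<dots> = (\<Sum>i\<le>degree f. coeff f i * c (int (Suc i) - k))"
    by (subst sum.atMost_Suc_shift) simp
  finally show ?thesis
    by (simp add: moment_form_def algebra_simps)
qed

lemma moment_form_reflect:
  assumes "\<And>k. c (- k) = c k"
  shows "moment_form c (reflect_poly f) k = moment_form c f (int (degree f) - k)"
proof -
  have "moment_form c (reflect_poly f) k =
      (\<Sum>i\<le>degree f. coeff (reflect_poly f) i * c (int i - k))"
    \<comment> \<open>Reversal lowers the degree when \<open>f\<close> vanishes at 0, so the sum
      runs to \<open>degree f\<close> in all cases.\<close>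
    by (rule moment_form_eq) (rule degree_reflect_poly_le)
  also have "\<dots> = (\<Sum>i\<le>degree f. coeff f (degree f - i) * c (int i - k))"
    by (intro sum.cong) (auto simp: coeff_reflect_poly)
  also have "\<dots> = (\<Sum>i\<le>degree f. coeff f i * c (int (degree f - i) - k))"
    by (rule sum.reindex_bij_witness[of _ "\<lambda>i. degree f - i" "\<lambda>i. degree f - i"]) auto
  also have "\<dots> = (\<Sum>i\<le>degree f. coeff f i * c (int i - (int (degree f) - k)))"
  proof (intro sum.cong refl)
    fix i assume "i \<in> {..degree f}"
    then have "int (degree f - i) - k = - (int i - (int (degree f) - k))"
      by simp
    then show "coeff f i * c (int (degree f - i) - k) = coeff f i * c (int i - (int (degree f) - k))"
      by (metis assms)
  qed
  finally show ?thesis by (simp add: moment_form_def)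
qed

text \<open>In these identities \<open>r\<close> stands for \<open>p ^ (n - 1)\<close>, and \<open>a0\<close>, \<open>a1\<close>, \<open>s1\<close> for \<open>alpha (n - 1)\<close>, \<open>alpha n\<close>,
  \<open>subleading n\<close>, etc.\<close>

lemma eliminate_diagonal:
  fixes p b r B a0 a1 a2 s1 s2 :: "'a::idom"
  assumes "a1 = - b * (p * r) * a2 + B * a1 - b * r * (1 - a1\<^sup>2) * a0"
    and "p * r - b * r * s1 = - b * (p * r) * s2 + B"
    and "s2 = s1 + a1 * a2"
  shows "(1 - p * r) * a1 - b * r * (p - 1) * s1 * a1 + b * (1 - a1\<^sup>2) * r * (p * a2 + a0) = 0"
  using assms by algebra

text \<open>The case n = 1, with r = 1, \<open>alpha 0 = 1\<close> and s1 = a1 already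
  substituted.\<close>

lemma first_integral_0:
  fixes p b a1 a2 :: "'a::idom"
  assumes "(1 - p) * a1 - b * (p - 1) * a1 * a1 + b * (1 - a1\<^sup>2) * (p * a2 + 1) = 0"
  shows "b * p * (1 - a1\<^sup>2) * a2 = (p - 1) * a1 + b * (p * a1\<^sup>2 - 1)"
  using assms by algebra

text \<open>A combination of the hypotheses suffices: the first integral at n, \<open>p * a2\<close>
  times the recurrence at n, and \<open>a1\<close> times the recurrence at n + 1. Nothing is
  cancelled, so \<open>alpha\<close> may vanish.\<close>

lemma first_integral_step:
  fixes p b r a0 a1 a2 a3 s1 s2 :: "'a::idom"
  assumes "b * (p * r) * (1 - a1\<^sup>2) * a0 * a2 = (p - 1) * s1 + b * ((p * r) * a1\<^sup>2 - 1)"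
    and "(1 - p * r) * a1 - b * r * (p - 1) * s1 * a1 + b * (1 - a1\<^sup>2) * r * (p * a2 + a0) = 0"
    and "(1 - p * (p * r)) * a2 - b * (p * r) * (p - 1) * s2 * a2 + b * (1 - a2\<^sup>2) * (p * r) * (p * a3 + a1) = 0"
    and "s2 = s1 + a1 * a2"
  shows "b * (p * (p * r)) * (1 - a2\<^sup>2) * a1 * a3 = (p - 1) * s2 + b * ((p * (p * r)) * a2\<^sup>2 - 1)"
  using assms by algebra

text \<open>Expand the product on the left: the term in a0 a2 comes from the first integral times
  \<open>b * r * a1\<^sup>2\<close>, the terms linear in a0 and a2 from the recurrence times
  \<open>a1\<close>. The two occurrences of \<open>s1\<close> cancel.\<close>

lemma painleve_step:
  fixes p b r a0 a1 a2 s1 :: "'a::idom"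
  assumes "b * (p * r) * (1 - a1\<^sup>2) * a0 * a2 = (p - 1) * s1 + b * ((p * r) * a1\<^sup>2 - 1)"
    and "(1 - p * r) * a1 - b * r * (p - 1) * s1 * a1 + b * (1 - a1\<^sup>2) * r * (p * a2 + a0) = 0"
  shows "(1 - a1\<^sup>2) * (b * (p * r) * a1 * a2 - 1) * (b * r * a0 * a1 - 1) =
    ((p * r) * a1\<^sup>2 - 1) * (b\<^sup>2 * r * a1\<^sup>2 - 1)"
  using assms by algebra

text \<open>The algebraic content of a positive weight invariant under z -> 1/z: \<open>sym\<close>
  allows working without conjugation, \<open>nondeg\<close> replaces positivity, and
  \<open>orth\<close> tests against monomials only.\<close>

locale monic_orthogonal =
  fixes c :: "int \<Rightarrow> 'a::field" and P :: "nat \<Rightarrow> 'a poly"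
  assumes sym: "\<And>k. c (- k) = c k"
    and nondeg: "\<And>f. (\<And>k. k \<le> degree f \<Longrightarrow> moment_form c f (int k) = 0) \<Longrightarrow> f = 0"
    and degree_P [simp]: "\<And>n. degree (P n) = n"
    and monic: "\<And>n. coeff (P n) n = 1"
    and orth: "\<And>k n. k < n \<Longrightarrow> moment_form c (P n) (int k) = 0"
begin

text \<open>Since \<open>P n\<close> is monic and orthogonal to lower powers, this is <P_n,
  P_n>.\<close>

definition sqnorm where "sqnorm n = moment_form c (P n) (int n)"
definition alpha where "alpha n = coeff (P n) 0"
text \<open>The value 0 at n = 0 makes the recursion for \<open>subleading\<close> start correctly:
  \<open>subleading 1 = alpha 0 * alpha 1\<close>.\<close>

definition subleading where "subleading n = (if n = 0 then 0 else coeff (P n) (n - 1))"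

lemma sqnorm_nonzero: "sqnorm n \<noteq> 0"
proof
  assume "sqnorm n = 0"
  then have "P n = 0"
    by (intro nondeg) (auto simp: sqnorm_def le_less orth)
  then show False using monic[of n] by simp
qed

lemma moment_form_reflect_P:
  "moment_form c (reflect_poly (P n)) k = moment_form c (P n) (int n - k)"
  using moment_form_reflect[of c "P n" k] sym by simp

lemma P_0: "P 0 = 1"
  using monic[of 0] degree_P[of 0] by (metis degree_0_id one_pCons of_nat_0 degree_eq_zeroE coeff_pCons_0)

lemma alpha_0 [simp]: "alpha 0 = 1"
  by (simp add: alpha_def P_0)

text \<open>For a symmetric form the reversed polynomial is obtained without conjugating coefficients.\<close>

lemma szego: "P (Suc n) = pCons 0 (P n) + smult (alpha (Suc n)) (reflect_poly (P n))"
proof -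
  \<comment> \<open>The defect \<open>E\<close> has no constant term and degree at most n, so it is
    z F with F of degree below n. F is orthogonal to 1, ..., z^(n-1), hence zero.\<close>
  define E where "E = P (Suc n) - pCons 0 (P n) - smult (alpha (Suc n)) (reflect_poly (P n))"
  have E0: "coeff E 0 = 0"
    by (simp add: E_def alpha_def monic)
  have "coeff E (Suc n) = 0"
    by (simp add: E_def monic coeff_reflect_poly)
  moreover have "degree E \<le> Suc n"
    unfolding E_def using degree_reflect_poly_le[of "P n"]
    by (intro degree_diff_le degree_smult_le[THEN order_trans] degree_pCons_le[THEN order_trans]) auto
  ultimately have degE: "degree E \<le> n"
    by (metis eq_zero_or_degree_less degree_0 le_SucE less_Suc_eq_le zero_le leading_coeff_0_iff)
  obtain F where F: "E = pCons 0 F"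
    using E0 by (metis coeff_pCons_0 pCons_cases)
  have "F = 0"
  proof (rule ccontr)
    assume "F \<noteq> 0"
    then have degF: "Suc (degree F) \<le> n"
      using degE F by simp
    have "F = 0"
    proof (rule nondeg)
      fix k assume "k \<le> degree F"
      then have k: "k < n" using degF by simp
      have "moment_form c F (int k) = moment_form c E (int (Suc k))"
        by (simp add: F moment_form_pCons_0)
      also have "\<dots> = moment_form c (P (Suc n)) (int (Suc k)) - moment_form c (P n) (int k)
          - alpha (Suc n) * moment_form c (P n) (int (n - Suc k))"
        using k by (simp add: E_def moment_form_diff moment_form_smult moment_form_pCons_0
            moment_form_reflect_P of_nat_diff)
      also have "\<dots> = 0"
        using k by (simp only: orth) (simp add: orth)
      finally show "moment_form c F (int k) = 0" .
    qed
    with \<open>F \<noteq> 0\<close> show False ..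
  qed
  then have "E = 0" by (simp add: F)
  then show ?thesis by (simp add: E_def algebra_simps)
qed

text \<open>Pair Szego's recursion with 1 to find <P_n, z^(-1)>, then with z^(n+1), where the
  reversed polynomial contributes the same quantity.\<close>

lemma sqnorm_Suc: "sqnorm (Suc n) = (1 - (alpha (Suc n))\<^sup>2) * sqnorm n"
proof -
  have "0 = moment_form c (P (Suc n)) (int 0)"
    by (simp only: orth)
  also have "\<dots> = moment_form c (P n) (- 1) + alpha (Suc n) * sqnorm n"
    by (subst szego) (simp add: moment_form_add moment_form_smult moment_form_pCons_0
        moment_form_reflect_P sqnorm_def)
  finally have *: "moment_form c (P n) (- 1) = - alpha (Suc n) * sqnorm n"
    by (simp add: eq_neg_iff_add_eq_0)
  have "sqnorm (Suc n) = sqnorm n + alpha (Suc n) * moment_form c (P n) (- 1)"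
    unfolding sqnorm_def by (subst szego) (simp add: moment_form_add moment_form_smult
        moment_form_pCons_0 moment_form_reflect_P)
  then show ?thesis
    by (simp add: * algebra_simps power2_eq_square)
qed

text \<open>This is what keeps the denominators of the final equations away from zero.\<close>

lemma alpha_Suc_square: "1 - (alpha (Suc n))\<^sup>2 \<noteq> 0"
  using sqnorm_Suc[of n] sqnorm_nonzero[of "Suc n"] by auto

lemma subleading_Suc: "subleading (Suc n) = subleading n + alpha n * alpha (Suc n)"
proof -
  have "coeff (P (Suc n)) n = coeff (pCons 0 (P n)) n + alpha (Suc n) * alpha n"
    by (subst szego) (simp add: coeff_reflect_poly alpha_def)
  then show ?thesis
    by (cases n) (simp_all add: subleading_def mult.commute)
qed

end

section \<open>The q-Pearson recurrence\<close>

locale q_pearson = monic_orthogonal c P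
  for c :: "int \<Rightarrow> 'a::field" and P +
  fixes p b :: 'a
  assumes p_nonzero: "p \<noteq> 0"
    and pearson: "c k - b * c (k - 1) = p powi k * (c k - b * c (k + 1))"
begin

text \<open>Dilation puts p^i = p^k p^(i-k) on the i-th coefficient. Applying \<open>pearson\<close>
  at i - k absorbs p^(i-k) and moves the factor 1 - bz from the first slot of the pairing to the
  second.\<close>

lemma moment_form_dilate:
  assumes "F = pcompose f [:0, p:] - smult b (pCons 0 (pcompose f [:0, p:]))"
  shows "moment_form c F (int k) = p ^ k * (moment_form c f (int k) - b * moment_form c f (int k + 1))"
proof -
  have deg: "degree (pcompose f [:0, p:]) = degree f"
    using p_nonzero by (simp add: degree_pcompose)
  have "moment_form c F (int k) =
      (\<Sum>i\<le>degree f. coeff f i * (p ^ i * (c (int i - int k) - b * c (int i - int k + 1))))"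
    unfolding assms
    by (simp add: moment_form_diff moment_form_smult moment_form_pCons_0, simp add: moment_form_def deg
        coeff_pcompose_linear sum_distrib_left sum_subtractf[symmetric])
       (intro sum.cong refl, simp add: algebra_simps)
  also have "\<dots> = (\<Sum>i\<le>degree f. coeff f i * (p ^ k * (c (int i - int k) - b * c (int i - int k - 1))))"
  proof (intro sum.cong refl)
    fix i
    have "p ^ i = p ^ k * p powi (int i - int k)"
      using p_nonzero by (simp add: power_int_diff)
    then show "coeff f i * (p ^ i * (c (int i - int k) - b * c (int i - int k + 1))) =
        coeff f i * (p ^ k * (c (int i - int k) - b * c (int i - int k - 1)))"
      by (simp add: pearson mult.assoc)
  qed
  also have "\<dots> = p ^ k * (moment_form c f (int k) - b * moment_form c f (int k + 1))"
    by (simp add: moment_form_def sum_distrib_left sum_subtractf[symmetric])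
       (intro sum.cong refl, simp add: algebra_simps)
  finally show ?thesis .
qed

text \<open>After subtracting the three multiples, the remainder \<open>G\<close> has degree at most
  m and is orthogonal to 1, ..., z^m, so it vanishes. \<open>B\<close> is left implicit because it
  is eliminated afterwards.\<close>

lemma dilate_expansion:
  fixes m :: nat
  defines "n \<equiv> Suc m"
  defines "D \<equiv> pcompose (P n) [:0, p:]"
  shows "\<exists>B. D - smult b (pCons 0 D) =
    smult (- b * p ^ n) (P (Suc n)) + smult B (P n) + smult (- b * p ^ m * (1 - (alpha n)\<^sup>2)) (P m)"
proof -
  \<comment> \<open>\<open>C\<close> is forced by pairing with z^m, and \<open>B\<close> below by
    the coefficient of z^n.\<close>
  define C where "C = - b * p ^ m * (1 - (alpha n)\<^sup>2)"
  define Q where "Q = D - smult b (pCons 0 D)"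
  define B where "B = coeff Q n + b * p ^ n * coeff (P (Suc n)) n"
  define G where "G = Q + smult (b * p ^ n) (P (Suc n)) - smult B (P n) - smult C (P m)"
  have degD: "degree D = n"
    using p_nonzero by (simp add: D_def degree_pcompose)
  have coeffD: "coeff D i = p ^ i * coeff (P n) i" for i
    by (simp add: D_def coeff_pcompose_linear)
  have M_Q: "moment_form c Q (int k) =
      p ^ k * (moment_form c (P n) (int k) - b * moment_form c (P n) (int (Suc k)))" for k
    using moment_form_dilate[OF refl, of "P n" k] by (simp add: Q_def D_def add.commute)
  have high: "coeff G i = 0" if "i > m" for i
  proof -
    consider "i = n" | "i = Suc n" | "i > Suc n"
      using \<open>i > m\<close> unfolding n_def by linarith
    then show ?thesis
    proof cases
      case 1
      then show ?thesis
        using coeff_eq_0[of "P m" n] by (simp add: G_def B_def monic n_def)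
    next
      case 2
      then show ?thesis
        using degD coeff_eq_0[of D "Suc n"] coeff_eq_0[of "P n" "Suc n"] coeff_eq_0[of "P m" "Suc n"]
        by (simp add: G_def Q_def monic coeffD n_def)
    next
      case 3
      then show ?thesis
        using degD by (simp add: G_def Q_def coeff_pCons coeff_eq_0 n_def split: nat.split)
    qed
  qed
  then have degG: "degree G \<le> m"
    by (intro degree_le) auto
  have "G = 0"
  proof (rule nondeg)
    fix k assume "k \<le> degree G"
    then have "k \<le> m" using degG by simp
    then consider "k < m" | "k = m" by linarith
    then show "moment_form c G (int k) = 0"
    proof cases
      case 1
      have "moment_form c (P (Suc n)) (int k) = 0" "moment_form c (P n) (int k) = 0"
        "moment_form c (P m) (int k) = 0" "moment_form c (P n) (int (Suc k)) = 0"
        using 1 by (intro orth; simp add: n_def)+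
      then show ?thesis
        unfolding G_def moment_form_diff moment_form_add moment_form_smult M_Q by simp
    next
      case 2
      have "moment_form c (P (Suc n)) (int m) = 0" "moment_form c (P n) (int m) = 0"
        by (intro orth; simp add: n_def)+
      moreover have "moment_form c (P n) (int (Suc m)) = (1 - (alpha n)\<^sup>2) * sqnorm m"
        using sqnorm_Suc[of m] by (simp only: sqnorm_def n_def)
      moreover have "moment_form c (P m) (int m) = sqnorm m"
        by (simp add: sqnorm_def)
      ultimately show ?thesis
        unfolding G_def moment_form_diff moment_form_add moment_form_smult M_Q 2 by (simp add: C_def)
    qed
  qed
  then have "Q = smult (- b * p ^ n) (P (Suc n)) + smult B (P n) + smult C (P m)"
    unfolding G_def by (simp add: algebra_simps add_eq_0_iff)
  then show ?thesis
    unfolding Q_def C_def by blast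
qed

text \<open>Compare the coefficients of z^0 and z^n in \<open>dilate_expansion\<close> and eliminate
  \<open>B\<close> between the two equations.\<close>

lemma alpha_recurrence:
  "(1 - p ^ Suc m) * alpha (Suc m) - b * p ^ m * (p - 1) * subleading (Suc m) * alpha (Suc m)
    + b * (1 - (alpha (Suc m))\<^sup>2) * p ^ m * (p * alpha (Suc (Suc m)) + alpha m) = 0"
proof -
  define n where "n = Suc m"
  define D where "D = pcompose (P n) [:0, p:]"
  obtain B where B: "D - smult b (pCons 0 D) =
    smult (- b * p ^ n) (P (Suc n)) + smult B (P n) + smult (- b * p ^ m * (1 - (alpha n)\<^sup>2)) (P m)"
    using dilate_expansion[of m] unfolding D_def n_def by blast
  have coeffD: "coeff D i = p ^ i * coeff (P n) i" for i
    by (simp add: D_def coeff_pcompose_linear)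
  from B have "coeff (D - smult b (pCons 0 D)) 0 =
    coeff (smult (- b * p ^ n) (P (Suc n)) + smult B (P n) + smult (- b * p ^ m * (1 - (alpha n)\<^sup>2)) (P m)) 0"
    by (rule arg_cong)
  then have 0: "alpha n = - b * p ^ n * alpha (Suc n) + B * alpha n - b * p ^ m * (1 - (alpha n)\<^sup>2) * alpha m"
    by (simp add: coeffD alpha_def)
  from B have "coeff (D - smult b (pCons 0 D)) n =
    coeff (smult (- b * p ^ n) (P (Suc n)) + smult B (P n) + smult (- b * p ^ m * (1 - (alpha n)\<^sup>2)) (P m)) n"
    by (rule arg_cong)
  then have 1: "p ^ n - b * p ^ m * subleading n = - b * p ^ n * subleading (Suc n) + B"
    using coeff_eq_0[of "P m" n]
    by (simp add: coeffD subleading_def monic n_def mult.assoc)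
  have 2: "subleading (Suc n) = subleading n + alpha n * alpha (Suc n)"
    by (rule subleading_Suc)
  show ?thesis
    using 0 1 2 unfolding n_def power_Suc by (rule eliminate_diagonal)
qed

text \<open>A first integral: eliminating the nonlocal quantity \<open>subleading\<close> between this and
  \<open>alpha_recurrence\<close> gives the second-order equation.\<close>

lemma first_integral:
  "b * p ^ Suc m * (1 - (alpha (Suc m))\<^sup>2) * alpha m * alpha (Suc (Suc m)) =
    (p - 1) * subleading (Suc m) + b * (p ^ Suc m * (alpha (Suc m))\<^sup>2 - 1)"
proof (induction m)
  case 0
  have "subleading (Suc 0) = alpha (Suc 0)"
    using subleading_Suc[of 0] by (simp add: subleading_def)
  then show ?case
    using alpha_recurrence[of 0] first_integral_0[of p "alpha 1" b "alpha (Suc 1)"] by simp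
next
  case (Suc m)
  show ?case
    using Suc.IH alpha_recurrence[of m] alpha_recurrence[of "Suc m"] subleading_Suc[of "Suc m"]
    unfolding power_Suc by (rule first_integral_step)
qed

theorem alpha_painleve:
  "(1 - (alpha (Suc m))\<^sup>2) * (b * p ^ Suc m * alpha (Suc m) * alpha (Suc (Suc m)) - 1)
      * (b * p ^ m * alpha m * alpha (Suc m) - 1) =
    (p ^ Suc m * (alpha (Suc m))\<^sup>2 - 1) * (b\<^sup>2 * p ^ m * (alpha (Suc m))\<^sup>2 - 1)"
  using first_integral[of m] alpha_recurrence[of m] unfolding power_Suc by (rule painleve_step)

end

section \<open>Moments of a weight on the unit circle\<close>

definition circle_mean :: "real \<Rightarrow> (complex \<Rightarrow> complex) \<Rightarrow> complex" where
  "circle_mean r F = integral {0..1} (\<lambda>t. F (of_real r * exp (2 * of_real pi * \<i> * of_real t)))"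

lemma contour_integral_eq_circle_mean:
  assumes "r > 0"
  shows "contour_integral (circlepath 0 r) (\<lambda>z. F z / (2 * complex_of_real pi * \<i> * z)) = circle_mean r F"
  unfolding contour_integral_integral circle_mean_def vector_derivative_circlepath
  using assms by (simp add: circlepath)

lemma circle_mean_cong:
  assumes "r > 0" "\<And>z. norm z = r \<Longrightarrow> F z = G z"
  shows "circle_mean r F = circle_mean r G"
  unfolding circle_mean_def
  by (rule integral_cong) (use assms in \<open>auto simp: norm_mult\<close>)

lemma circle_mean_integrable:
  fixes F :: "complex \<Rightarrow> complex"
  assumes "r > 0" "continuous_on (sphere 0 r) F"
  shows "(\<lambda>t::real. F (of_real r * exp (2 * of_real pi * \<i> * of_real t))) integrable_on {0..1}"
  by (intro integrable_continuous_real
      continuous_on_compose2[OF assms(2), of _ "\<lambda>t. of_real r * exp (2 * of_real pi * \<i> * of_real t)"])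
     (use assms(1) in \<open>auto intro!: continuous_intros simp: norm_mult\<close>)

lemma circle_mean_diff:
  assumes "r > 0" "continuous_on (sphere 0 r) F" "continuous_on (sphere 0 r) G"
  shows "circle_mean r (\<lambda>z. F z - G z) = circle_mean r F - circle_mean r G"
  unfolding circle_mean_def
  by (intro integral_diff circle_mean_integrable assms)

lemma circle_mean_cmult: "circle_mean r (\<lambda>z. a * F z) = a * circle_mean r F"
  unfolding circle_mean_def by simp

lemma circle_mean_sum:
  assumes "r > 0" "finite I" "\<And>i. i \<in> I \<Longrightarrow> continuous_on (sphere 0 r) (F i)"
  shows "circle_mean r (\<lambda>z. \<Sum>i\<in>I. F i z) = (\<Sum>i\<in>I. circle_mean r (F i))"
  unfolding circle_mean_def
  by (intro integral_sum circle_mean_integrable assms)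

lemma circle_mean_dilate: "circle_mean r (\<lambda>z. F (of_real s * z)) = circle_mean (s * r) F"
  by (simp add: circle_mean_def mult.assoc)

text \<open>Inversion is t -> 1 - t in the angle, carried out as a reflection onto [-1, 0] followed
  by a translation by 1.\<close>

lemma circle_mean_inverse: "circle_mean 1 (\<lambda>z. F (inverse z)) = circle_mean 1 F"
proof -
  let ?e = "\<lambda>t. exp (2 * of_real pi * \<i> * of_real t)"
  have shift: "?e (1 - t) = inverse (?e t)" for t :: real
    by (simp add: right_diff_distrib exp_diff exp_minus[symmetric] field_simps)
  have "circle_mean 1 F = integral {0..1} (\<lambda>t. F (?e t))"
    by (simp add: circle_mean_def)
  also have "\<dots> = integral {-1..-0} (\<lambda>t. F (?e (- t)))"
    by (rule Henstock_Kurzweil_Integration.integral_reflect_real[symmetric])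
  also have "\<dots> = integral {0..1} (\<lambda>t. F (?e (1 - t)))"
    using integral_shift_real_ivl[of 0 "1" 1 "\<lambda>t. F (?e (1 - t))"] by (simp add: algebra_simps)
  also have "\<dots> = circle_mean 1 (\<lambda>z. F (inverse z))"
    by (simp only: shift circle_mean_def of_real_1 mult_1)
  finally show ?thesis ..
qed

lemma circle_mean_radius:
  assumes hol: "F holomorphic_on {z. r1 < norm z \<and> norm z < r2}"
    and "0 \<le> r1" "r1 < s" "s < r2" "r1 < t" "t < r2"
  shows "circle_mean s F = circle_mean t F"
proof -
  let ?S = "{z::complex. r1 < norm z \<and> norm z < r2}"
  have pos: "0 < s" "0 < t" using assms by auto
  have "contour_integral (circlepath 0 s) (\<lambda>z. F z / (2 * complex_of_real pi * \<i> * z)) =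
        contour_integral (circlepath 0 t) (\<lambda>z. F z / (2 * complex_of_real pi * \<i> * z))"
  proof (rule Cauchy_theorem_homotopic_loops)
    show "open ?S"
      by (intro open_Collect_conj open_Collect_less continuous_intros)
    show "(\<lambda>z. F z / (2 * complex_of_real pi * \<i> * z)) holomorphic_on ?S"
      using assms(2) by (intro holomorphic_intros hol) auto
    \<comment> \<open>Points of the two circles with equal parameter lie on one ray, so the straight
      homotopy stays in the annulus.\<close>
    show "homotopic_loops ?S (circlepath 0 s) (circlepath 0 t)"
    proof (rule homotopic_loops_linear)
      fix x :: real
      show "closed_segment (circlepath 0 s x) (circlepath 0 t x) \<subseteq> ?S"
      proof
        fix y assume "y \<in> closed_segment (circlepath 0 s x) (circlepath 0 t x)"
        then obtain u where u: "0 \<le> u" "u \<le> 1"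
          and y: "y = (1 - u) *\<^sub>R circlepath 0 s x + u *\<^sub>R circlepath 0 t x"
          by (auto simp: closed_segment_def)
        have y': "y = of_real ((1 - u) * s + u * t) * exp (2 * of_real pi * \<i> * of_real x)"
          unfolding y circlepath by (simp add: scaleR_conv_of_real algebra_simps)
        have "(1 - u) * s + u * t \<in> closed_segment s t"
          using u by (auto simp: closed_segment_def)
        then have *: "r1 < (1 - u) * s + u * t \<and> (1 - u) * s + u * t < r2"
          using assms by (auto simp: closed_segment_eq_real_ivl split: if_splits)
        then have "norm y = (1 - u) * s + u * t"
          unfolding y' norm_mult norm_of_real using assms(2) by simp
        with * show "y \<in> ?S" by simp
      qed
    qed auto
  qed auto
  then show ?thesis
    by (simp add: contour_integral_eq_circle_mean pos)
qed

section \<open>Moments of a weight and definiteness of its inner product\<close>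

definition circle_moment :: "(complex \<Rightarrow> complex) \<Rightarrow> int \<Rightarrow> complex" where
  "circle_moment w k = circle_mean 1 (\<lambda>z. z powi k * w z)"

lemma continuous_on_powi_sphere:
  fixes r :: real
  assumes "r > 0" shows "continuous_on (sphere 0 r) (\<lambda>z::complex. z powi k)"
  using assms by (intro continuous_intros) auto

text \<open>On the unit circle conjugation is inversion, so z^i times the conjugate of z^j is
  z^(i-j).\<close>

lemma circle_inner_eq_moments:
  assumes cont: "continuous_on (sphere 0 1) w"
  shows "circle_inner w (poly f) (poly g) =
    (\<Sum>j\<le>degree g. cnj (coeff g j) * moment_form (circle_moment w) f (int j))"
proof -
  have "circle_inner w (poly f) (poly g) =
      circle_mean 1 (\<lambda>z. poly f z * cnj (poly g z) * w z)"
    unfolding circle_inner_def by (rule contour_integral_eq_circle_mean) simp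
  also have "\<dots> = circle_mean 1 (\<lambda>z. \<Sum>j\<le>degree g. \<Sum>i\<le>degree f.
      (cnj (coeff g j) * coeff f i) * (z powi (int i - int j) * w z))"
  proof (rule circle_mean_cong)
    fix z :: complex assume "norm z = 1"
    then have "z * cnj z = 1"
      by (simp flip: complex_norm_square)
    then have z: "z \<noteq> 0" "cnj z = inverse z"
      by (auto simp: inverse_unique)
    have *: "z ^ i * cnj (z ^ j) = z powi (int i - int j)" for i j :: nat
      unfolding complex_cnj_power z(2)
      using z(1) by (simp add: power_int_diff power_inverse divide_inverse)
    have "poly f z * cnj (poly g z) * w z =
        (\<Sum>j\<le>degree g. \<Sum>i\<le>degree f. (coeff f i * z ^ i) * cnj (coeff g j * z ^ j) * w z)"
      unfolding poly_altdef cnj_sum sum_product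
      by (subst sum.swap) (simp add: sum_distrib_right)
    also have "\<dots> = (\<Sum>j\<le>degree g. \<Sum>i\<le>degree f.
        (cnj (coeff g j) * coeff f i) * ((z ^ i * cnj (z ^ j)) * w z))"
      by (intro sum.cong refl) simp
    finally show "poly f z * cnj (poly g z) * w z = (\<Sum>j\<le>degree g. \<Sum>i\<le>degree f.
      (cnj (coeff g j) * coeff f i) * (z powi (int i - int j) * w z))"
      by (simp only: *)
  qed simp
  also have "\<dots> = (\<Sum>j\<le>degree g. \<Sum>i\<le>degree f.
      (cnj (coeff g j) * coeff f i) * circle_moment w (int i - int j))"
    unfolding circle_moment_def circle_mean_cmult[symmetric]
    by (subst circle_mean_sum; (intro sum.cong refl circle_mean_sum)?)
       (auto intro!: continuous_on_sum continuous_on_mult continuous_on_const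
          continuous_on_powi_sphere cont)
  also have "\<dots> = (\<Sum>j\<le>degree g. cnj (coeff g j) * moment_form (circle_moment w) f (int j))"
    by (simp add: moment_form_def sum_distrib_left mult.assoc)
  finally show ?thesis .
qed

text \<open>The integrand |f|^2 w is continuous and nonnegative; a zero integral makes it vanish
  identically, so \<open>f\<close> has infinitely many roots.\<close>

lemma circle_inner_definite:
  assumes cont: "continuous_on (sphere 0 1) w"
    and pos: "\<And>z. norm z = 1 \<Longrightarrow> \<exists>v>0. w z = of_real v"
    and 0: "circle_inner w (poly f) (poly f) = 0"
  shows "f = 0"
proof -
  define e where "e = (\<lambda>t. exp (2 * of_real pi * \<i> * of_real t) :: complex)"
  have norm_e: "norm (e t) = 1" for t by (simp add: e_def)
  have cont_e: "continuous_on A e" for A unfolding e_def by (intro continuous_intros)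
  define g where "g = (\<lambda>t. (norm (poly f (e t)))\<^sup>2 * Re (w (e t)))"
  have cont_g: "continuous_on {0..1} g"
    unfolding g_def
    by (intro continuous_intros cont_e continuous_on_compose2[OF cont cont_e]) (auto simp: norm_e)
  have eq: "poly f (e t) * cnj (poly f (e t)) * w (e t) = of_real (g t)" for t
    using pos[OF norm_e[of t]] by (auto simp: g_def simp flip: complex_norm_square)
  have "circle_inner w (poly f) (poly f) = circle_mean 1 (\<lambda>z. poly f z * cnj (poly f z) * w z)"
    unfolding circle_inner_def by (rule contour_integral_eq_circle_mean) simp
  also have "\<dots> = integral {0..1} (\<lambda>t. of_real (g t))"
    unfolding circle_mean_def eq[symmetric] by (simp add: e_def)
  also have "\<dots> = of_real (integral {0..1} g)"
    by (intro integral_unique has_integral_of_real integrable_integral integrable_continuous_real cont_g)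
  finally have "integral {0..1} g = 0" using 0 by simp
  moreover have "g t \<ge> 0" for t
    using pos[OF norm_e[of t]] by (auto simp: g_def)
  ultimately have g0: "\<forall>t\<in>{0..1}. g t = 0"
    using integral_eq_0_iff[OF cont_g] by simp
  have "poly f z = 0" if "norm z = 1" for z
  proof -
    have "z \<in> path_image (circlepath 0 1)" using that by simp
    then obtain t where t: "t \<in> {0..1}" "z = e t"
      unfolding path_image_def by (auto simp: circlepath e_def)
    then show ?thesis
      using g0 pos[OF that] by (auto simp: g_def)
  qed
  then have "sphere 0 1 \<subseteq> {z. poly f z = 0}" by auto
  moreover have "infinite (sphere (0::complex) 1)"
  proof
    assume "finite (sphere (0::complex) 1)"
    moreover have "connected (sphere (0::complex) 1)"
      by (rule connected_sphere) simp
    ultimately consider "sphere (0::complex) 1 = {}" | a where "sphere (0::complex) 1 = {a}"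
      using connected_finite_iff_sing[of "sphere (0::complex) 1"] by metis
    then have "(1::complex) = -1"
    proof cases
      case 1
      then have "(1::complex) \<in> {}" by (metis dist_0_norm mem_sphere norm_one)
      then show ?thesis ..
    next
      case (2 a)
      have "(1::complex) \<in> sphere 0 1" "-1 \<in> sphere (0::complex) 1" by auto
      then show ?thesis unfolding 2 by simp
    qed
    then show False by simp
  qed
  ultimately show "f = 0"
    using poly_roots_finite finite_subset by blast
qed

text \<open>Dilation by p carries the circle of radius 1 / sqrt p to that of radius sqrt p. This
  symmetric pair, rather than radii 1 and p, keeps both contours inside the annulus of holomorphy
  for every \<xi> below 1.\<close>

lemma circle_moment_pearson:
  fixes p :: real and b :: complex
  assumes p: "p > 0"
    and hol: "w holomorphic_on {z. r1 < norm z \<and> norm z < r2}"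
    and "0 \<le> r1" "r1 < 1" "1 < r2" "r1 < sqrt p" "sqrt p < r2" "r1 < 1 / sqrt p" "1 / sqrt p < r2"
    and fe: "\<And>z. norm z = 1 / sqrt p \<Longrightarrow> w (of_real p * z) * (1 - b / (of_real p * z)) = w z * (1 - b * z)"
  shows "circle_moment w k - b * circle_moment w (k - 1) =
    of_real p powi k * (circle_moment w k - b * circle_moment w (k + 1))"
proof -
  let ?S = "{z::complex. r1 < norm z \<and> norm z < r2}"
  have S0: "z \<noteq> 0" if "z \<in> ?S" for z using that \<open>0 \<le> r1\<close> by auto
  have cont: "continuous_on (sphere 0 1) w"
    by (rule continuous_on_subset[OF holomorphic_on_imp_continuous_on[OF hol]])
       (use assms in auto)
  have cont': "continuous_on (sphere 0 1) (\<lambda>z. z powi j * w z)" for j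
    by (intro continuous_intros cont continuous_on_powi_sphere) simp
  have cont'': "continuous_on (sphere 0 1) (\<lambda>z. b * (z powi j * w z))" for j
    by (intro continuous_on_mult_left cont')
  define G where "G = (\<lambda>z. z powi k * (w z * (1 - b / z)))"
  define H where "H = (\<lambda>z. z powi k * (w z * (1 - b * z)))"
  have holG: "G holomorphic_on ?S" and holH: "H holomorphic_on ?S"
    unfolding G_def H_def using S0 by (auto intro!: holomorphic_intros hol)
  have "circle_moment w k - b * circle_moment w (k - 1) =
      circle_mean 1 (\<lambda>z. z powi k * w z - b * (z powi (k - 1) * w z))"
    unfolding circle_moment_def circle_mean_cmult[symmetric]
    by (rule circle_mean_diff[symmetric]) (use cont' cont'' in auto)
  also have "\<dots> = circle_mean 1 G"
  proof (rule circle_mean_cong)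
    fix z :: complex assume "norm z = 1"
    then have "z \<noteq> 0" by auto
    then show "z powi k * w z - b * (z powi (k - 1) * w z) = G z"
      by (simp add: G_def power_int_diff field_simps)
  qed simp
  also have "\<dots> = circle_mean (sqrt p) G"
    by (rule circle_mean_radius[OF holG]) (use assms in auto)
  also have "\<dots> = circle_mean (1 / sqrt p) (\<lambda>z. G (of_real p * z))"
    using p by (simp add: circle_mean_dilate real_div_sqrt)
  also have "\<dots> = circle_mean (1 / sqrt p) (\<lambda>z. of_real p powi k * H z)"
    by (rule circle_mean_cong) (use p fe in \<open>auto simp: G_def H_def power_int_mult_distrib mult.assoc\<close>)
  also have "\<dots> = of_real p powi k * circle_mean 1 H"
    unfolding circle_mean_cmult
    by (rule arg_cong, rule circle_mean_radius[OF holH]) (use assms in auto)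
  also have "circle_mean 1 H = circle_mean 1 (\<lambda>z. z powi k * w z - b * (z powi (k + 1) * w z))"
  proof (rule circle_mean_cong)
    fix z :: complex assume "norm z = 1"
    then have "z \<noteq> 0" by auto
    then show "H z = z powi k * w z - b * (z powi (k + 1) * w z)"
      by (simp add: H_def power_int_add algebra_simps)
  qed simp
  also have "\<dots> = circle_moment w k - b * circle_moment w (k + 1)"
    unfolding circle_moment_def circle_mean_cmult[symmetric]
    by (rule circle_mean_diff) (use cont' cont'' in auto)
  finally show ?thesis .
qed

lemma circle_moment_symmetric:
  assumes "\<And>z. norm z = 1 \<Longrightarrow> w (inverse z) = w z"
  shows "circle_moment w (- k) = circle_moment w k"
proof -
  have "circle_moment w (- k) = circle_mean 1 (\<lambda>z. inverse z powi k * w (inverse z))"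
    unfolding circle_moment_def
    by (rule circle_mean_cong) (use assms in \<open>auto simp: power_int_minus power_int_inverse\<close>)
  also have "\<dots> = circle_moment w k"
    unfolding circle_moment_def by (rule circle_mean_inverse)
  finally show ?thesis .
qed

text \<open>Orthogonality to all lower \<open>P k\<close> becomes orthogonality to monomials by
  strong induction: in <P_n, P_k> only the leading term of \<open>P k\<close> survives.\<close>

lemma monic_orthogonal_circle:
  assumes cont: "continuous_on (sphere 0 1) w"
    and pos: "\<And>z. norm z = 1 \<Longrightarrow> \<exists>v>0. w z = of_real v"
    and sym: "\<And>z. norm z = 1 \<Longrightarrow> w (inverse z) = w z"
    and P: "monic_orthogonal_polys w P"
  shows "monic_orthogonal (circle_moment w) P"
proof
  have deg: "degree (P n) = n" and lead: "coeff (P n) n = 1" for n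
    using P unfolding monic_orthogonal_polys_def by metis+
  show "circle_moment w (- k) = circle_moment w k" for k
    by (rule circle_moment_symmetric) (rule sym)
  show "f = 0" if "\<And>k. k \<le> degree f \<Longrightarrow> moment_form (circle_moment w) f (int k) = 0" for f
    by (rule circle_inner_definite[OF cont pos])
       (simp_all add: circle_inner_eq_moments[OF cont] that)
  show "degree (P n) = n" "coeff (P n) n = 1" for n by fact+
  show "moment_form (circle_moment w) (P n) (int k) = 0" if "k < n" for k n
    using that
  proof (induction k rule: less_induct)
    case (less k)
    have "0 = circle_inner w (poly (P n)) (poly (P k))"
      using P less.prems unfolding monic_orthogonal_polys_def by auto
    also have "\<dots> = (\<Sum>j\<le>k. cnj (coeff (P k) j) * moment_form (circle_moment w) (P n) (int j))"
      by (simp add: circle_inner_eq_moments[OF cont] deg)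
    also have "\<dots> = (\<Sum>j\<in>{k}. cnj (coeff (P k) j) * moment_form (circle_moment w) (P n) (int j))"
      by (rule sum.mono_neutral_right) (use less in auto)
    finally show ?case by (simp add: lead)
  qed
qed

section \<open>The two weights\<close>

text \<open>The infinite q-Pochhammer symbol (t; q).\<close>

definition q_poch :: "real \<Rightarrow> complex \<Rightarrow> complex" where
  "q_poch q t = (\<Prod>k. 1 - t * of_real q ^ k)"

context
  fixes q :: real
  assumes q: "0 < q" "q < 1"
begin

lemma summable_q_poch: "summable (\<lambda>k. norm (t * of_real q ^ k :: complex))"
  using q by (simp add: norm_mult norm_power summable_mult)

lemma convergent_q_poch: "convergent_prod (\<lambda>k. 1 - t * of_real q ^ k :: complex)"
proof -
  have "abs_convergent_prod (\<lambda>k. 1 - t * of_real q ^ k :: complex)"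
    unfolding abs_convergent_prod_conv_summable using summable_q_poch[of t] by simp
  then show ?thesis by (rule abs_convergent_prod_imp_convergent_prod)
qed

lemma q_poch_LIMSEQ: "(\<lambda>n. \<Prod>k\<le>n. 1 - t * of_real q ^ k) \<longlonglongrightarrow> q_poch q t"
  unfolding q_poch_def by (rule convergent_prod_LIMSEQ[OF convergent_q_poch])

lemma q_poch_shift: "q_poch q t = (1 - t) * q_poch q (t * of_real q)"
proof (rule LIMSEQ_unique)
  show "(\<lambda>n. \<Prod>k\<le>Suc n. 1 - t * of_real q ^ k) \<longlonglongrightarrow> q_poch q t"
    by (rule LIMSEQ_Suc[OF q_poch_LIMSEQ])
  have "(\<lambda>n. (1 - t) * (\<Prod>k\<le>n. 1 - t * of_real q * of_real q ^ k))
      \<longlonglongrightarrow> (1 - t) * q_poch q (t * of_real q)"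
    by (intro tendsto_intros q_poch_LIMSEQ)
  then show "(\<lambda>n. \<Prod>k\<le>Suc n. 1 - t * of_real q ^ k) \<longlonglongrightarrow> (1 - t) * q_poch q (t * of_real q)"
    by (simp only: prod.atMost_Suc_shift power_0 mult_1_right power_Suc mult.assoc)
qed

lemma q_poch_nonzero:
  assumes "norm t < 1"
  shows "q_poch q t \<noteq> 0"
  unfolding q_poch_def
proof (rule prodinf_nonzero[OF convergent_q_poch])
  fix k
  have "norm t * q ^ k < 1"
    using assms q by (metis less_le_not_le mult_left_le mult_le_one norm_ge_zero order.strict_trans1 power_le_one less_imp_le)
  then have "norm (t * of_real q ^ k) < 1"
    using q by (simp add: norm_mult norm_power)
  then show "1 - t * of_real q ^ k \<noteq> 0" by auto
qed

lemma q_poch_cnj: "q_poch q (cnj t) = cnj (q_poch q t)"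
proof (rule LIMSEQ_unique[OF q_poch_LIMSEQ])
  have "(\<lambda>n. cnj (\<Prod>k\<le>n. 1 - t * of_real q ^ k)) \<longlonglongrightarrow> cnj (q_poch q t)"
    by (rule tendsto_cnj[OF q_poch_LIMSEQ])
  then show "(\<lambda>n. \<Prod>k\<le>n. 1 - cnj t * of_real q ^ k) \<longlonglongrightarrow> cnj (q_poch q t)"
    by (simp add: cnj_prod)
qed

text \<open>The partial products converge uniformly on each closed unit disc around x, by the M-test
  with majorant (|x| + 1) q^n.\<close>

lemma holomorphic_q_poch: "q_poch q holomorphic_on UNIV"
proof (rule holomorphic_uniform_sequence[where f = "\<lambda>n t. \<Prod>k<n. 1 - t * of_real q ^ k"])
  fix x :: complex
  have "uniformly_convergent_on (cball x 1) (\<lambda>n t. \<Prod>k<n. 1 + - (t * of_real q ^ k))"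
  proof (rule Infinite_Products.uniformly_convergent_on_prod)
    show "uniformly_convergent_on (cball x 1) (\<lambda>N t. \<Sum>n<N. norm (- (t * of_real q ^ n)))"
    proof (rule Weierstrass_m_test')
      fix n t assume "t \<in> cball x 1"
      then have "norm t \<le> norm x + 1"
        using norm_triangle_sub[of t x] by (simp add: dist_norm norm_minus_commute)
      then show "norm (norm (- (t * of_real q ^ n))) \<le> (norm x + 1) * q ^ n"
        using q by (simp add: norm_mult norm_power mult_right_mono)
    qed (use q in \<open>simp add: summable_mult\<close>)
  qed (auto intro!: continuous_intros)
  then obtain l where l: "uniform_limit (cball x 1) (\<lambda>n t. \<Prod>k<n. 1 - t * of_real q ^ k) l sequentially"
    unfolding uniformly_convergent_on_def by auto
  have "l t = q_poch q t" if "t \<in> cball x 1" for t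
    using tendsto_uniform_limitI[OF l that] q_poch_LIMSEQ[of t]
    by (metis LIMSEQ_lessThan_iff_atMost LIMSEQ_unique)
  then have "uniform_limit (cball x 1) (\<lambda>n t. \<Prod>k<n. 1 - t * of_real q ^ k) (q_poch q) sequentially"
    using l by (subst uniform_limit_cong'[of _ _ _ _ l]) auto
  then show "\<exists>d>0. cball x d \<subseteq> UNIV \<and>
      uniform_limit (cball x d) (\<lambda>n t. \<Prod>k<n. 1 - t * of_real q ^ k) (q_poch q) sequentially"
    using zero_less_one by blast
qed (auto intro!: holomorphic_intros)

lemma holomorphic_q_poch_compose [holomorphic_intros]:
  assumes "f holomorphic_on A"
  shows "(\<lambda>z. q_poch q (f z)) holomorphic_on A"
  using holomorphic_on_compose_gen[OF assms holomorphic_q_poch] by (simp add: o_def)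

lemma powr_half_shift: "q powr (real k + 1/2) = sqrt q * q ^ k"
  using q by (simp add: powr_add powr_realpow powr_half_sqrt)

section \<open>The two weights as q-Pochhammer products, and their analytic properties\<close>

lemma weight_I_eq:
  "weight_I q \<xi> z = inverse (q_poch q (of_real (\<xi> * sqrt q) * z) * q_poch q (of_real (\<xi> * sqrt q) * inverse z))"
proof -
  have "weight_I q \<xi> z = (\<Prod>k. inverse ((1 - (of_real (\<xi> * sqrt q) * z) * of_real q ^ k) *
      (1 - (of_real (\<xi> * sqrt q) * inverse z) * of_real q ^ k)))"
    unfolding weight_I_def powr_half_shift by (simp add: divide_inverse mult_ac)
  also have "\<dots> = inverse (\<Prod>k. (1 - (of_real (\<xi> * sqrt q) * z) * of_real q ^ k) *
      (1 - (of_real (\<xi> * sqrt q) * inverse z) * of_real q ^ k))"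
    by (intro prodinf_inverse convergent_prod_mult convergent_q_poch)
  also have "\<dots> = inverse (q_poch q (of_real (\<xi> * sqrt q) * z) * q_poch q (of_real (\<xi> * sqrt q) * inverse z))"
    unfolding q_poch_def by (subst prodinf_mult) (intro convergent_q_poch refl)+
  finally show ?thesis .
qed

lemma weight_I_check_eq:
  "weight_I_check q \<xi> z = q_poch q (- of_real (\<xi> * sqrt q) * z) * q_poch q (- of_real (\<xi> * sqrt q) * inverse z)"
proof -
  have "weight_I_check q \<xi> z = (\<Prod>k. (1 - (- of_real (\<xi> * sqrt q) * z) * of_real q ^ k) *
      (1 - (- of_real (\<xi> * sqrt q) * inverse z) * of_real q ^ k))"
    unfolding weight_I_check_def powr_half_shift by (simp add: mult_ac)
  also have "\<dots> = q_poch q (- of_real (\<xi> * sqrt q) * z) * q_poch q (- of_real (\<xi> * sqrt q) * inverse z)"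
    unfolding q_poch_def by (subst prodinf_mult) (intro convergent_q_poch refl)+
  finally show ?thesis .
qed

text \<open>For real \<open>a\<close> and |z| = 1 the second factor is the conjugate of the first,
  so the product is a squared modulus.\<close>

lemma q_poch_circle_positive:
  assumes "norm z = 1" "\<bar>a\<bar> < 1"
  shows "\<exists>v>0. q_poch q (of_real a * z) * q_poch q (of_real a * inverse z) = of_real v"
proof -
  have "z * cnj z = 1" using assms(1) by (simp flip: complex_norm_square)
  then have "inverse z = cnj z" by (rule inverse_unique)
  then have "q_poch q (of_real a * inverse z) = cnj (q_poch q (of_real a * z))"
    using q_poch_cnj[of "of_real a * z"] by simp
  then have "q_poch q (of_real a * z) * q_poch q (of_real a * inverse z) =
      of_real ((norm (q_poch q (of_real a * z)))\<^sup>2)"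
    by (simp flip: complex_norm_square)
  moreover have "q_poch q (of_real a * z) \<noteq> 0"
    by (rule q_poch_nonzero) (use assms in \<open>simp add: norm_mult\<close>)
  ultimately show ?thesis by (metis zero_less_norm_iff zero_less_power)
qed

text \<open>In this annulus both q-Pochhammer arguments have modulus below 1, so the denominator has
  no zeros.\<close>

lemma holomorphic_weight_I:
  assumes "0 < \<xi>"
  shows "weight_I q \<xi> holomorphic_on {z. \<xi> * sqrt q < norm z \<and> norm z < 1 / (\<xi> * sqrt q)}"
proof -
  define a where "a = \<xi> * sqrt q"
  have a: "a > 0" using assms q by (simp add: a_def)
  have "(\<lambda>z. inverse (q_poch q (of_real a * z) * q_poch q (of_real a * inverse z)))
      holomorphic_on {z. a < norm z \<and> norm z < 1 / a}"
  proof (intro holomorphic_intros)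
    fix z :: complex assume z: "z \<in> {z. a < norm z \<and> norm z < 1 / a}"
    then have pos: "norm z > 0" using a by auto
    then show "z \<noteq> 0" by auto
    have "norm (of_real a * z) < 1" "norm (of_real a * inverse z) < 1"
      using z a pos by (auto simp: norm_mult norm_divide field_simps)
    then show "q_poch q (of_real a * z) * q_poch q (of_real a * inverse z) \<noteq> 0"
      using q_poch_nonzero by simp
  qed
  then show ?thesis
    by (simp only: weight_I_eq[abs_def] a_def)
qed

lemma holomorphic_weight_I_check:
  assumes "0 \<notin> A"
  shows "weight_I_check q \<xi> holomorphic_on A"
proof -
  have "(\<lambda>z. q_poch q (- of_real (\<xi> * sqrt q) * z) * q_poch q (- of_real (\<xi> * sqrt q) * inverse z)) holomorphic_on A"
    using assms by (intro holomorphic_intros) auto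
  then show ?thesis
    by (simp only: weight_I_check_eq[abs_def])
qed

text \<open>Replacing z by qz removes one factor from the first product and adds one to the second.
  On the given circle both az and a/(qz) have modulus \<xi> < 1, so these factors may be
  cancelled.\<close>

lemma weight_I_pearson:
  assumes "0 < \<xi>" "\<xi> < 1" "norm z = 1 / sqrt q"
  shows "weight_I q \<xi> (of_real q * z) * (1 - of_real (\<xi> * sqrt q) / (of_real q * z)) =
    weight_I q \<xi> z * (1 - of_real (\<xi> * sqrt q) * z)"
proof -
  define a where "a = complex_of_real (\<xi> * sqrt q)"
  have z0: "z \<noteq> 0" using assms q by auto
  have "norm (a * z) = \<xi>"
    using assms q by (simp add: a_def norm_mult)
  moreover have "norm (a / (of_real q * z)) = \<xi> * (sqrt q * sqrt q / q)"
    using assms q by (simp only: a_def norm_mult norm_divide norm_of_real) (simp add: field_simps)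
  ultimately have "norm (a * z) < 1" "norm (a / (of_real q * z)) < 1"
    using assms q by simp_all
  then have nz: "1 - a * z \<noteq> 0" "1 - a / (of_real q * z) \<noteq> 0" by auto
  have 1: "q_poch q (a * z) = (1 - a * z) * q_poch q (a * (of_real q * z))"
    using q_poch_shift[of "a * z"] by (simp add: mult_ac)
  have 2: "q_poch q (a * inverse (of_real q * z)) = (1 - a / (of_real q * z)) * q_poch q (a * inverse z)"
    using q_poch_shift[of "a * inverse (of_real q * z)"] q by (simp add: divide_inverse mult_ac)
  show ?thesis
    unfolding weight_I_eq a_def[symmetric] 1 2 using nz by (simp add: inverse_mult_distrib)
qed

text \<open>The same shift with p = 1/q. Here the weight is a product rather than a reciprocal, so
  no factor is divided out and any nonzero z is allowed.\<close>

lemma weight_I_check_pearson: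
  assumes "z \<noteq> 0"
  shows "weight_I_check q \<xi> (of_real (1 / q) * z) *
      (1 - of_real (- \<xi> * sqrt (1 / q)) / (of_real (1 / q) * z)) =
    weight_I_check q \<xi> z * (1 - of_real (- \<xi> * sqrt (1 / q)) * z)"
proof -
  define a where "a = complex_of_real (\<xi> * sqrt q)"
  have b: "complex_of_real (- \<xi> * sqrt (1 / q)) = - a / of_real q"
    using q by (simp add: a_def real_sqrt_divide field_simps flip: of_real_mult)
  have 1: "q_poch q (- a * (of_real (1 / q) * z)) = (1 + a / of_real q * z) * q_poch q (- a * z)"
    using q_poch_shift[of "- a * (of_real (1 / q) * z)"] q by simp
  have 2: "q_poch q (- a * inverse z) = (1 + a / z) * q_poch q (- a * inverse (of_real (1 / q) * z))"
    using q_poch_shift[of "- a * inverse z"] q by (simp add: divide_inverse mult_ac)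
  show ?thesis
    unfolding weight_I_check_eq a_def[symmetric] b 1 2 using q assms by (simp add: mult_ac)
qed

lemma weight_I_circle:
  assumes "norm z = 1" "0 < \<xi>" "\<xi> < 1"
  shows "\<exists>v>0. weight_I q \<xi> z = of_real v"
    and "\<exists>v>0. weight_I_check q \<xi> z = of_real v"
proof -
  have "\<xi> * sqrt q < 1 * 1"
    using assms q by (intro mult_strict_mono) auto
  then have a: "\<bar>\<xi> * sqrt q\<bar> < 1" "\<bar>- (\<xi> * sqrt q)\<bar> < 1"
    using assms q by auto
  obtain v where "v > 0" "q_poch q (of_real (\<xi> * sqrt q) * z) * q_poch q (of_real (\<xi> * sqrt q) * inverse z) = of_real v"
    using q_poch_circle_positive[OF assms(1) a(1)] by blast
  then have "inverse v > 0" "weight_I q \<xi> z = of_real (inverse v)"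
    by (simp_all only: weight_I_eq of_real_inverse inverse_positive_iff_positive)
  then show "\<exists>v>0. weight_I q \<xi> z = of_real v" by blast
  show "\<exists>v>0. weight_I_check q \<xi> z = of_real v"
    using q_poch_circle_positive[OF assms(1) a(2)] unfolding weight_I_check_eq of_real_minus .
qed

lemma weight_inverse:
  "weight_I q \<xi> (inverse z) = weight_I q \<xi> z"
  "weight_I_check q \<xi> (inverse z) = weight_I_check q \<xi> z"
  by (simp_all add: weight_I_eq weight_I_check_eq mult.commute)

text \<open>The equations involve the half-integer normalisations only through squares and products
  of neighbours, where a single square root remains.\<close>

lemma powr_half_powers:
  "\<xi> > 0 \<Longrightarrow> (\<xi> powr (1/2) * q powr (real n / 2)) * (\<xi> powr (1/2) * q powr (real n / 2)) = \<xi> * q ^ n"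
  "\<xi> > 0 \<Longrightarrow> (\<xi> powr (1/2) * q powr (real n / 2)) * (\<xi> powr (1/2) * q powr (real (Suc n) / 2)) = \<xi> * sqrt q * q ^ n"
  "q powr - (real n / 2) * q powr - (real n / 2) = (1 / q) ^ n"
  "q powr - (real n / 2) * q powr - (real (Suc n) / 2) = sqrt (1 / q) * (1 / q) ^ n"
proof -
  have half: "q powr (real n / 2) = sqrt q ^ n" for n
  proof -
    have "sqrt q ^ n = (q powr (1/2)) powr real n"
      using q by (simp add: powr_half_sqrt powr_realpow)
    then show ?thesis by (simp add: powr_powr)
  qed
  have sq: "sqrt q ^ n * sqrt q ^ n = q ^ n"
    using q by (simp flip: power_mult_distrib)
  have mhalf: "q powr - (real n / 2) = inverse (sqrt q ^ n)" for n
    by (simp add: powr_minus half)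
  show "\<xi> > 0 \<Longrightarrow> (\<xi> powr (1/2) * q powr (real n / 2)) * (\<xi> powr (1/2) * q powr (real n / 2)) = \<xi> * q ^ n"
    unfolding half by (simp add: powr_half_sqrt sq[symmetric] mult_ac)
  show "\<xi> > 0 \<Longrightarrow> (\<xi> powr (1/2) * q powr (real n / 2)) * (\<xi> powr (1/2) * q powr (real (Suc n) / 2)) = \<xi> * sqrt q * q ^ n"
    unfolding half by (simp add: powr_half_sqrt sq[symmetric] mult_ac)
  show "q powr - (real n / 2) * q powr - (real n / 2) = (1 / q) ^ n"
    unfolding mhalf power_one_over sq[symmetric] by (simp add: divide_inverse)
  show "q powr - (real n / 2) * q powr - (real (Suc n) / 2) = sqrt (1 / q) * (1 / q) ^ n"
    unfolding mhalf power_one_over sq[symmetric] by (simp add: divide_inverse real_sqrt_inverse mult_ac)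
qed

end

text \<open>Common form of both equations, used with (p, \<eta>) = (q, \<xi>) and (1/q, -\<xi>). The
  sequence \<open>x\<close> enters through \<open>sq\<close> and \<open>prod\<close> alone, so no
  square root of \<eta> has to be chosen.\<close>

lemma circle_weight_painleve:
  fixes p \<eta> :: real
  assumes p: "p > 0" and \<eta>: "\<eta> \<noteq> 0"
    and hol: "w holomorphic_on {z. r1 < norm z \<and> norm z < r2}"
    and "0 \<le> r1" "r1 < 1" "1 < r2" "r1 < sqrt p" "sqrt p < r2" "r1 < 1 / sqrt p" "1 / sqrt p < r2"
    and fe: "\<And>z. norm z = 1 / sqrt p \<Longrightarrow>
      w (of_real p * z) * (1 - of_real (\<eta> * sqrt p) / (of_real p * z)) = w z * (1 - of_real (\<eta> * sqrt p) * z)"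
    and pos: "\<And>z. norm z = 1 \<Longrightarrow> \<exists>v>0. w z = of_real v"
    and sym: "\<And>z. norm z = 1 \<Longrightarrow> w (inverse z) = w z"
    and P: "monic_orthogonal_polys w P"
    and sq: "\<And>n. (x n)\<^sup>2 = of_real (\<eta> * p ^ n) * (poly (P n) 0)\<^sup>2"
    and prod: "\<And>n. x n * x (Suc n) = of_real (\<eta> * sqrt p * p ^ n) * poly (P n) 0 * poly (P (Suc n)) 0"
    and n: "n \<ge> 1"
    and E: "E = inverse (complex_of_real \<eta>) * inverse (of_real p ^ n)"
  shows "1 - E * (x n)\<^sup>2 \<noteq> 0 \<and>
    (x n * x (n + 1) - 1) * (x (n - 1) * x n - 1) =
      ((x n)\<^sup>2 - of_real \<eta>) * ((x n)\<^sup>2 - inverse (of_real \<eta>)) / (1 - E * (x n)\<^sup>2)"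
proof -
  define b where "b = complex_of_real (\<eta> * sqrt p)"
  have cont: "continuous_on (sphere 0 1) w"
    by (rule continuous_on_subset[OF holomorphic_on_imp_continuous_on[OF hol]])
       (use assms in auto)
  interpret monic_orthogonal "circle_moment w" P
    by (rule monic_orthogonal_circle[OF cont pos sym P])
  interpret q_pearson "circle_moment w" P "of_real p" b
  proof
    show "complex_of_real p \<noteq> 0" using p by simp
    show "circle_moment w k - b * circle_moment w (k - 1) =
        of_real p powi k * (circle_moment w k - b * circle_moment w (k + 1))" for k
      using assms unfolding b_def by (intro circle_moment_pearson[of p w r1 r2]) auto
  qed
  obtain m where m: "n = Suc m" using n by (cases n) auto
  have alpha: "poly (P k) 0 = alpha k" for k by (simp add: alpha_def poly_0_coeff_0)
  have b2: "b\<^sup>2 = of_real (\<eta>\<^sup>2 * p)"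
    using p by (simp add: b_def power_mult_distrib flip: of_real_power)
  \<comment> \<open>The coefficient \<open>E\<close> undoes the normalisation of \<open>x n\<close>,
    which identifies the denominator with the factor in \<open>alpha_Suc_square\<close>.\<close>
  have D: "1 - E * (x n)\<^sup>2 = 1 - (alpha n)\<^sup>2"
    using p \<eta> by (simp add: E sq alpha field_simps)
  have "(x n * x (n + 1) - 1) * (x (n - 1) * x n - 1) * (1 - (alpha n)\<^sup>2) =
      (1 - (alpha n)\<^sup>2) * (b * of_real p ^ n * alpha n * alpha (Suc n) - 1) * (b * of_real p ^ m * alpha m * alpha n - 1)"
    using prod[of n] prod[of m] by (simp add: m b_def alpha)
  also have "\<dots> = (of_real p ^ n * (alpha n)\<^sup>2 - 1) * (b\<^sup>2 * of_real p ^ m * (alpha n)\<^sup>2 - 1)"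
    unfolding m by (rule alpha_painleve)
  also have "\<dots> = ((x n)\<^sup>2 - of_real \<eta>) * ((x n)\<^sup>2 - inverse (of_real \<eta>))"
    unfolding sq b2 alpha m using \<eta> by (simp add: field_simps power2_eq_square)
  finally show ?thesis
    unfolding D using alpha_Suc_square[of m] by (simp add: m eq_divide_eq)
qed

theorem theorem1p3:
  fixes q \<xi> :: real
    and P P_check :: "nat \<Rightarrow> complex poly"
    and s :: complex
    and x y :: "nat \<Rightarrow> complex"
  assumes "0 < q" "q < 1" "0 < \<xi>" "\<xi> < 1"
    and "monic_orthogonal_polys (weight_I q \<xi>) P"
    and "monic_orthogonal_polys (weight_I_check q \<xi>) P_check"
    and "s ^ 2 = - complex_of_real \<xi>"
    and "\<And>n. x n = complex_of_real (\<xi> powr (1/2) * q powr (real n / 2)) * poly (P n) 0"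
    and "\<And>n. y n = s * complex_of_real (q powr (- (real n / 2))) * poly (P_check n) 0"
  shows "(\<forall>n\<ge>1.
            1 - inverse (complex_of_real \<xi>) * complex_of_real (q powr (- real n)) * x n ^ 2 \<noteq> 0 \<and>
            (x n * x (n + 1) - 1) * (x (n - 1) * x n - 1) =
              (x n ^ 2 - complex_of_real \<xi>) * (x n ^ 2 - inverse (complex_of_real \<xi>)) /
              (1 - inverse (complex_of_real \<xi>) * complex_of_real (q powr (- real n)) * x n ^ 2)) \<and>
         (\<forall>n\<ge>1.
            1 + inverse (complex_of_real \<xi>) * complex_of_real (q ^ n) * y n ^ 2 \<noteq> 0 \<and>
            (y n * y (n + 1) - 1) * (y (n - 1) * y n - 1) =
              (y n ^ 2 + complex_of_real \<xi>) * (y n ^ 2 + inverse (complex_of_real \<xi>)) /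
              (1 + inverse (complex_of_real \<xi>) * complex_of_real (q ^ n) * y n ^ 2)) \<and>
         x 0 = complex_of_real (\<xi> powr (1/2)) \<and> y 0 = s"
proof -
  note q = assms(1,2) and xi = assms(3,4)
  \<comment> \<open>This chain places the radii sqrt q, 1 and 1 / sqrt q inside the annulus for both
    weights.\<close>
  have a: "0 < \<xi> * sqrt q" "\<xi> * sqrt q < sqrt q" "sqrt q < 1" "1 < 1 / sqrt q" "1 / sqrt q < 1 / (\<xi> * sqrt q)"
  proof -
    show pos: "0 < \<xi> * sqrt q" and less: "\<xi> * sqrt q < sqrt q" and "sqrt q < 1"
      using q xi by simp_all
    then show "1 < 1 / sqrt q" using q by simp
    show "1 / sqrt q < 1 / (\<xi> * sqrt q)"
      using pos less by (intro divide_strict_left_mono) (use q in auto)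
  qed
  have P0: "poly (Q 0) 0 = 1" if "monic_orthogonal_polys w Q" for w Q
  proof -
    have "degree (Q 0) = 0" "coeff (Q 0) (degree (Q 0)) = 1"
      using that unfolding monic_orthogonal_polys_def by metis+
    then show ?thesis unfolding poly_0_coeff_0 by metis
  qed
  have x0: "x 0 = complex_of_real (\<xi> powr (1/2))" and y0: "y 0 = s"
    unfolding assms(8)[of 0] assms(9)[of 0] P0[OF assms(5)] P0[OF assms(6)]
    using q by simp_all
  have r: "\<xi> * sqrt q < 1" "1 < 1 / (\<xi> * sqrt q)" "sqrt q < 1 / (\<xi> * sqrt q)"
    "\<xi> * sqrt q < 1 / sqrt q"
    using a by linarith+
  have x: "1 - inverse (complex_of_real \<xi>) * complex_of_real (q powr (- real n)) * x n ^ 2 \<noteq> 0 \<and>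
      (x n * x (n + 1) - 1) * (x (n - 1) * x n - 1) =
        (x n ^ 2 - complex_of_real \<xi>) * (x n ^ 2 - inverse (complex_of_real \<xi>)) /
        (1 - inverse (complex_of_real \<xi>) * complex_of_real (q powr (- real n)) * x n ^ 2)"
    if n: "n \<ge> 1" for n
  proof -
    have sq: "(x n)\<^sup>2 = of_real (\<xi> * q ^ n) * (poly (P n) 0)\<^sup>2" for n
      unfolding assms(8) powr_half_powers(1)[OF q xi(1), symmetric] power2_eq_square by simp
    have prod: "x n * x (Suc n) = of_real (\<xi> * sqrt q * q ^ n) * poly (P n) 0 * poly (P (Suc n)) 0" for n
      unfolding assms(8) powr_half_powers(2)[OF q xi(1), symmetric] by simp
    have E: "inverse (complex_of_real \<xi>) * complex_of_real (q powr (- real n)) =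
        inverse (complex_of_real \<xi>) * inverse (of_real q ^ n)"
      using q by (simp add: powr_minus powr_realpow)
    have "\<xi> \<noteq> 0" using xi by simp
    note w = holomorphic_weight_I[OF q xi(1)] weight_I_pearson[OF q xi]
      weight_I_circle(1)[OF q _ xi] weight_inverse(1)[OF q]
    show ?thesis
      by (rule circle_weight_painleve[OF q(1) \<open>\<xi> \<noteq> 0\<close> w(1) less_imp_le[OF a(1)] r(1,2) a(2) r(3,4) a(5)
        w(2,3,4) assms(5) sq prod n E])
  qed
  have y: "1 + inverse (complex_of_real \<xi>) * complex_of_real (q ^ n) * y n ^ 2 \<noteq> 0 \<and>
      (y n * y (n + 1) - 1) * (y (n - 1) * y n - 1) =
        (y n ^ 2 + complex_of_real \<xi>) * (y n ^ 2 + inverse (complex_of_real \<xi>)) /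
        (1 + inverse (complex_of_real \<xi>) * complex_of_real (q ^ n) * y n ^ 2)"
    if n: "n \<ge> 1" for n
  proof -
    have sq: "(y n)\<^sup>2 = of_real (- \<xi> * (1 / q) ^ n) * (poly (P_check n) 0)\<^sup>2" for n
    proof -
      have "(y n)\<^sup>2 = s\<^sup>2 * of_real (q powr - (real n / 2) * q powr - (real n / 2)) * (poly (P_check n) 0)\<^sup>2"
        unfolding assms(9) power2_eq_square of_real_mult by (simp only: mult_ac)
      then show ?thesis
        unfolding powr_half_powers(3)[OF q] assms(7) by simp
    qed
    have prod: "y n * y (Suc n) =
        of_real (- \<xi> * sqrt (1 / q) * (1 / q) ^ n) * poly (P_check n) 0 * poly (P_check (Suc n)) 0" for n
    proof -
      have "y n * y (Suc n) = s\<^sup>2 * of_real (q powr - (real n / 2) * q powr - (real (Suc n) / 2))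
          * poly (P_check n) 0 * poly (P_check (Suc n)) 0"
        unfolding assms(9) power2_eq_square by simp
      then show ?thesis
        unfolding powr_half_powers(4)[OF q] assms(7) by simp
    qed
    \<comment> \<open>The sign of \<eta> = -\<xi> is absorbed here, turning 1 - E y^2 into the
      stated denominator with a plus sign.\<close>
    let ?E = "- (inverse (complex_of_real \<xi>) * complex_of_real (q ^ n))"
    have E: "?E = inverse (complex_of_real (- \<xi>)) * inverse (of_real (1 / q) ^ n)"
      by (simp add: power_one_over)
    have hol: "weight_I_check q \<xi> holomorphic_on {z. \<xi> * sqrt q < norm z \<and> norm z < 1 / (\<xi> * sqrt q)}"
      by (rule holomorphic_weight_I_check[OF q]) (use a(1) in auto)
    have pearson: "weight_I_check q \<xi> (of_real (1 / q) * z) *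
          (1 - of_real (- \<xi> * sqrt (1 / q)) / (of_real (1 / q) * z)) =
        weight_I_check q \<xi> z * (1 - of_real (- \<xi> * sqrt (1 / q)) * z)"
      if "norm z = 1 / sqrt (1 / q)" for z
      by (rule weight_I_check_pearson[OF q]) (use that q in auto)
    have radii: "\<xi> * sqrt q < sqrt (1 / q)" "sqrt (1 / q) < 1 / (\<xi> * sqrt q)"
        "\<xi> * sqrt q < 1 / sqrt (1 / q)" "1 / sqrt (1 / q) < 1 / (\<xi> * sqrt q)"
      unfolding real_sqrt_divide real_sqrt_one div_by_1 divide_divide_eq_right mult_1 by (rule r a)+
    have nz: "0 < 1 / q" "- \<xi> \<noteq> 0"
      using q xi by simp_all
    have "1 - ?E * (y n)\<^sup>2 \<noteq> 0 \<and>
      (y n * y (n + 1) - 1) * (y (n - 1) * y n - 1) =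
        ((y n)\<^sup>2 - of_real (- \<xi>)) * ((y n)\<^sup>2 - inverse (of_real (- \<xi>))) / (1 - ?E * (y n)\<^sup>2)"
      by (rule circle_weight_painleve[OF nz hol less_imp_le[OF a(1)] r(1,2) radii
        pearson weight_I_circle(2)[OF q _ xi] weight_inverse(2)[OF q] assms(6) sq prod n E])
    then show ?thesis by simp
  qed
  show ?thesis
    using x y x0 y0 by blast
qed

end
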